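(* For every integer $r\ge 2$, $R^{\mathrm{KG}}_r(3,3)\ge 3r+2$.
   Context: The Kneser graph $\mathrm{KG}(n,r)$ has vertex set the $r$-element subsets of $[n]=\{1,\dots,n\}$, with two sets adjacent iff they are disjoint. The $r$-Kneser Ramsey number $R^{\mathrm{KG}}_r(s,t)$ is the minimum integer $n$ such that every red/blue edge-coloring of $\mathrm{KG}(n,r)$ contains a red $K_s$ (a set of $s$ pairwise adjacent vertices with all connecting edges red) or a blue $K_t$. *)

theory Defs
  imports "HOL-Library.Ramsey"
begin

definition kneser_verts :: "nat \<Rightarrow> nat \<Rightarrow> nat set set" where
  "kneser_verts n r = nsets {1..n} r"

(* For r > 0 disjoint r-sets are automatically distinct; the condition A \<noteq> B only
   excludes a loop at the empty set when r = 0. *)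
definition kneser_edges :: "nat \<Rightarrow> nat \<Rightarrow> nat set set set" where
  "kneser_edges n r =
     {{A, B} | A B. A \<in> kneser_verts n r \<and> B \<in> kneser_verts n r \<and> A \<noteq> B \<and> A \<inter> B = {}}"

datatype colour = Red | Blue

definition has_mono_clique ::
  "'a set \<Rightarrow> 'a set set \<Rightarrow> ('a set \<Rightarrow> colour) \<Rightarrow> colour \<Rightarrow> nat \<Rightarrow> bool" where
  "has_mono_clique V E c k s \<longleftrightarrow>
     (\<exists>S \<subseteq> V. finite S \<and> card S = s \<and> clique S {e \<in> E. c e = k})"

(* A colouring is a total function on sets of vertices; its values off the edge set are
   irrelevant. *)
definition kneser_arrows :: "nat \<Rightarrow> nat \<Rightarrow> nat \<Rightarrow> nat \<Rightarrow> bool" where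
  "kneser_arrows n r s t \<longleftrightarrow>
     (\<forall>c. has_mono_clique (kneser_verts n r) (kneser_edges n r) c Red s \<or>
          has_mono_clique (kneser_verts n r) (kneser_edges n r) c Blue t)"

(* For r > 0 the minimum exists by Ramsey's theorem: for large m, KG(m * r, r) contains a
   complete graph on m vertices, namely any m pairwise disjoint r-sets. *)
definition kneser_ramsey :: "nat \<Rightarrow> nat \<Rightarrow> nat \<Rightarrow> nat" where
  "kneser_ramsey r s t = (LEAST n. kneser_arrows n r s t)"

end

theory Submission
  imports Defs
begin

text \<open>
  Fix the two points 1 and 2 and colour an edge \<open>{A, B}\<close> red if 1 and 2 both lie
  outside \<open>A \<union> B\<close>, or if one of them lies in \<open>A\<close> and the other in \<open>B\<close>;
  colour it blue otherwise. Three disjoint \<open>r\<close>-sets in a ground set of at most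
  \<open>3 r + 1\<close> points cover at least one of 1 and 2. If both lie in one of the sets, the
  edge between the other two is red and the remaining edges are blue; if they lie in
  different sets, the edge between these is red and the remaining edges are blue; if just
  one of them is covered, the edge avoiding it is red and the remaining edges are blue.
\<close>

definition two_point_colouring :: "nat set set \<Rightarrow> colour" where
  "two_point_colouring e =
     (if (1 \<in> \<Union>e \<longleftrightarrow> 2 \<in> \<Union>e) \<and> (\<forall>A\<in>e. \<not> {1, 2} \<subseteq> A) then Red else Blue)"

lemma two_point_colouring_not_mono:
  assumes "A \<inter> B = {}" "A \<inter> C = {}" "B \<inter> C = {}"
    and "1 \<in> A \<union> B \<union> C \<or> 2 \<in> A \<union> B \<union> C"
  shows "\<not> (two_point_colouring {A, B} = k \<and> two_point_colouring {A, C} = k \<and>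
            two_point_colouring {B, C} = k)"
proof -
  have red_iff: "two_point_colouring {X, Y} = Red \<longleftrightarrow>
      (1 \<in> X \<or> 1 \<in> Y \<longleftrightarrow> 2 \<in> X \<or> 2 \<in> Y) \<and> \<not> (1 \<in> X \<and> 2 \<in> X) \<and> \<not> (1 \<in> Y \<and> 2 \<in> Y)"
    for X Y
    by (simp add: two_point_colouring_def)
  have disj: "\<not> (x \<in> A \<and> x \<in> B)" "\<not> (x \<in> A \<and> x \<in> C)" "\<not> (x \<in> B \<and> x \<in> C)" for x
    using assms(1-3) by blast+
  \<comment> \<open>Equal colours are reduced to equal redness, so \<open>k\<close> disappears. By
    \<open>red_iff\<close> only the six atoms "1 or 2 lies in \<open>A\<close>, \<open>B\<close> or
    \<open>C\<close>" remain, and the claim is propositional.\<close>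
  have "\<not> ((two_point_colouring {A, B} = Red \<longleftrightarrow> two_point_colouring {A, C} = Red) \<and>
      (two_point_colouring {A, B} = Red \<longleftrightarrow> two_point_colouring {B, C} = Red))"
    unfolding red_iff using disj[of 1] disj[of 2] assms(4)[unfolded Un_iff] by argo
  then show ?thesis
    by auto
qed

lemma doubleton_mem_kneser_edges:
  assumes "{A, B} \<in> kneser_edges n r"
  shows "A \<inter> B = {}"
  using assms by (auto simp: kneser_edges_def doubleton_eq_iff)

lemma card_disjoint_triple_diff:
  assumes "A \<in> kneser_verts n r" "B \<in> kneser_verts n r" "C \<in> kneser_verts n r"
    and "A \<inter> B = {}" "A \<inter> C = {}" "B \<inter> C = {}" and "n \<le> N" "3 * r \<le> N"
  shows "card ({1..N} - (A \<union> B \<union> C)) = N - 3 * r"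
proof -
  have fin: "finite A" "finite B" "finite C" and card: "card A = r" "card B = r" "card C = r"
    and sub: "A \<union> B \<union> C \<subseteq> {1..N}"
    using assms by (auto simp: kneser_verts_def nsets_def)
  have "card (A \<union> B \<union> C) = 3 * r"
    using assms fin card by (simp add: card_Un_disjoint Int_Un_distrib2)
  then show ?thesis
    using fin sub by (simp add: card_Diff_subset)
qed

text \<open>All \<open>n\<close> up to \<open>3 * r + 1\<close> are treated at once, so that the
  bound applies to the Ramsey number itself without an argument that arrowing is monotone in
  \<open>n\<close>.\<close>

lemma not_kneser_arrows:
  assumes "r \<ge> 1" "n \<le> 3 * r + 1"
  shows "\<not> kneser_arrows n r 3 3"
proof -
  have "\<not> has_mono_clique (kneser_verts n r) (kneser_edges n r) two_point_colouring k 3" for k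
  proof
    assume "has_mono_clique (kneser_verts n r) (kneser_edges n r) two_point_colouring k 3"
    then obtain S where S: "S \<subseteq> kneser_verts n r" "card S = 3"
      and cl: "clique S {e \<in> kneser_edges n r. two_point_colouring e = k}"
      by (auto simp: has_mono_clique_def)
    obtain A B C where ABC: "S = {A, B, C}" "A \<noteq> B" "B \<noteq> C" "A \<noteq> C"
      using S(2) by (auto simp: card_3_iff)
    then have edges: "{A, B} \<in> kneser_edges n r" "{A, C} \<in> kneser_edges n r"
        "{B, C} \<in> kneser_edges n r"
      and mono: "two_point_colouring {A, B} = k" "two_point_colouring {A, C} = k"
        "two_point_colouring {B, C} = k"
      using cl by (auto simp: clique_def)
    note disj = edges[THEN doubleton_mem_kneser_edges]
    \<comment> \<open>The triple is counted inside the larger ground set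
      \<open>{1..3 * r + 1}\<close>, where it misses exactly one point. This set contains 1 and,
      since \<open>r \<ge> 1\<close>, also 2, so the triple cannot miss both.\<close>
    have "card ({1..3 * r + 1} - (A \<union> B \<union> C)) = 1"
      using card_disjoint_triple_diff[of A n r B C "3 * r + 1"] S(1) ABC disj assms(2) by simp
    then obtain x where "{1..3 * r + 1} - (A \<union> B \<union> C) = {x}"
      by (auto simp: card_1_singleton_iff)
    then have "y = x" if "y \<in> {1..3 * r + 1}" "y \<notin> A \<union> B \<union> C" for y
      using that by blast
    from this[of 1] this[of 2] assms(1) have "1 \<in> A \<union> B \<union> C \<or> 2 \<in> A \<union> B \<union> C"
      by fastforce
    with two_point_colouring_not_mono[OF disj] mono show False
      by blast
  qed
  then show ?thesis
    by (auto simp: kneser_arrows_def)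
qed

text \<open>Cut the ground set into \<open>m\<close> consecutive blocks of length \<open>r\<close>.
  For \<open>r \<ge> 1\<close> the blocks are nonempty, so disjointness makes them distinct and
  there are really \<open>m\<close> of them.\<close>

lemma ex_disjoint_kneser_verts:
  assumes "r \<ge> 1"
  obtains V where "V \<subseteq> kneser_verts (m * r) r" "finite V" "card V = m" "pairwise disjnt V"
proof
  define f where "f i = {i * r + 1..i * r + r}" for i
  define V where "V = f ` {..<m}"
  have disj: "f i \<inter> f j = {}" if "i < j" for i j
  proof -
    \<comment> \<open>Block \<open>i\<close> ends at \<open>Suc i * r\<close>, and block
      \<open>j\<close> starts at \<open>j * r + 1\<close>.\<close>
    have "Suc i * r \<le> j * r"
      using that by (intro mult_right_mono) auto
    then show ?thesis
      by (auto simp: f_def)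
  qed
  have ne: "f i \<noteq> {}" for i
    using assms by (simp add: f_def)
  have "inj f"
  proof (rule linorder_injI)
    show "f i \<noteq> f j" if "i < j" for i j
      using disj[OF that] ne[of i] by auto
  qed
  then show "card V = m" "finite V"
    by (auto simp: V_def card_image inj_on_subset)
  show "pairwise disjnt V"
  proof (rule pairwiseI)
    fix A B assume "A \<in> V" "B \<in> V" "A \<noteq> B"
    then obtain i j where "A = f i" "B = f j" "i \<noteq> j"
      by (auto simp: V_def)
    then show "disjnt A B"
      using disj[of i j] disj[of j i] by (cases "i < j") (auto simp: disjnt_def Int_commute)
  qed
  have "f i \<in> kneser_verts (m * r) r" if "i < m" for i
  proof -
    have "Suc i * r \<le> m * r"
      using that by (intro mult_right_mono) auto
    then show ?thesis
      by (auto simp: f_def kneser_verts_def nsets_def)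
  qed
  then show "V \<subseteq> kneser_verts (m * r) r"
    by (auto simp: V_def)
qed

text \<open>This ensures that the \<open>LEAST\<close> in \<open>kneser_ramsey\<close> is attained;
  otherwise its value would say nothing about arrowing. Pairwise disjoint sets span a complete
  subgraph, to which the classical Ramsey theorem applies.\<close>

lemma ex_kneser_arrows:
  assumes "r \<ge> 1"
  shows "\<exists>n. kneser_arrows n r s t"
proof -
  obtain m where m: "\<And>(V :: nat set set) E. finite V \<Longrightarrow> card V \<ge> m \<Longrightarrow>
      \<exists>R\<subseteq>V. card R = s \<and> clique R E \<or> card R = t \<and> indep R E"
    using ramsey2[of s t] by blast
  obtain V where V: "V \<subseteq> kneser_verts (m * r) r" "finite V" "card V = m" "pairwise disjnt V"
    using ex_disjoint_kneser_verts[OF assms] .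
  have edge: "{A, B} \<in> kneser_edges (m * r) r" if "A \<in> V" "B \<in> V" "A \<noteq> B" for A B
  proof -
    have "A \<inter> B = {}" "A \<in> kneser_verts (m * r) r" "B \<in> kneser_verts (m * r) r"
      using that V pairwiseD[of disjnt V A B] by (auto simp: disjnt_def)
    with \<open>A \<noteq> B\<close> show ?thesis
      unfolding kneser_edges_def by blast
  qed
  have "kneser_arrows (m * r) r s t"
    unfolding kneser_arrows_def
  proof
    fix c :: "nat set set \<Rightarrow> colour"
    obtain R where R: "R \<subseteq> V"
      and mono: "card R = s \<and> clique R {e. c e = Red} \<or> card R = t \<and> indep R {e. c e = Red}"
      \<comment> \<open>The graph handed to Ramsey's theorem consists of the red pairs, so an
        independent set is a blue clique.\<close>
      using m[of V "{e. c e = Red}"] V by auto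
    \<comment> \<open>Every pair of distinct members of \<open>V\<close> is a Kneser edge, so
      restricting a colour class to \<open>kneser_edges\<close> loses no pair inside
      \<open>R\<close>.\<close>
    have mono_clique: "clique R {e \<in> kneser_edges (m * r) r. c e = k}"
      if "\<forall>A\<in>R. \<forall>B\<in>R. A \<noteq> B \<longrightarrow> c {A, B} = k" for k
      using that edge subsetD[OF R] by (simp add: clique_def)
    have not_Red: "x = Blue" if "x \<noteq> Red" for x
      using that by (cases x) auto
    have "finite R" "R \<subseteq> kneser_verts (m * r) r"
      using R V finite_subset by auto
    moreover have "clique R {e \<in> kneser_edges (m * r) r. c e = Red}" if "clique R {e. c e = Red}"
      using that by (intro mono_clique) (simp add: clique_def)
    moreover have "clique R {e \<in> kneser_edges (m * r) r. c e = Blue}" if "indep R {e. c e = Red}"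
      using that by (intro mono_clique ballI impI not_Red) (simp add: indep_def)
    ultimately show "has_mono_clique (kneser_verts (m * r) r) (kneser_edges (m * r) r) c Red s \<or>
        has_mono_clique (kneser_verts (m * r) r) (kneser_edges (m * r) r) c Blue t"
      using mono unfolding has_mono_clique_def by blast
  qed
  then show ?thesis ..
qed

theorem theorem1p11:
  fixes r :: nat
  assumes "r \<ge> 2"
  shows "kneser_ramsey r 3 3 \<ge> 3 * r + 2"
proof (rule ccontr)
  assume "\<not> ?thesis"
  then have "\<not> kneser_arrows (kneser_ramsey r 3 3) r 3 3"
    using assms by (intro not_kneser_arrows) auto
  moreover have "kneser_arrows (kneser_ramsey r 3 3) r 3 3"
    unfolding kneser_ramsey_def by (rule LeastI_ex[OF ex_kneser_arrows]) (use assms in simp)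
  ultimately show False
    by contradiction
qed

end
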